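(* Let $f_1,\dots,f_n:\mathbb{R}\to\mathbb{R}\cup\{+\infty\}$ be closed, proper and convex, let $\rho>0$, let $a_1,\dots,a_n\in\mathbb{R}$, and assume that the unaugmented Lagrangian $\mathcal{L}_0$ (defined in the context) admits a saddle point $(\mathbf{x}^\star,\mathbf{z}^\star,\mathbf{y}^\star)$. Let $\{(\mathbf{x}^t,\mathbf{z}^t,\mathbf{y}^t)\}_{t>0}$ be the sequence generated by the synchronous algorithm described in the context, and let $\mathbf{r}^t=\mathbf{z}^t-\mathbf{M}\mathbf{x}^t$ for $t>0$. Then $$\lim_{t\to\infty}\|\mathbf{r}^t\|=0,\qquad \lim_{t\to\infty} f(\mathbf{x}^t)=f(\mathbf{x}^\star).$$
   Context: Graph: $G=([n],E)$ is an undirected, connected, non-bipartite graph, $n\ge 2$, $m=|E|$; $N_k$ is the set of edges incident to node $k$ and $d_k=|N_k|$ its degree. Problem: $f(\mathbf{x})=\sum_{k=1}^n f_k(x_k)$ for $\mathbf{x}\in\mathbb{R}^n$. The matrix $\mathbf{M}\in\mathbb{R}^{2m\times n}$ stacks, over edges $e=(i,j)\in E$, the blocks $\mathbf{M}_e\in\mathbb{R}^{2\times n}$ with $\mathbf{M}_e\mathbf{x}=(x_i,x_j)^\top$. A vector of $\mathbb{R}^{2m}$ is written $\mathbf{z}=[\mathbf{z}_e]_{e\in E}$ with $\mathbf{z}_e\in\mathbb{R}^2$; for a vector $\mathbf{y}\in\mathbb{R}^{2m}$ and $e=(i,j)$ write $\mathbf{y}_e=(y_{e,i},y_{e,j})$.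 Let $C=\operatorname{span}(\mathbf{1}_2)\subset\mathbb{R}^2$, $\iota_C$ its convex indicator function ($0$ on $C$, $+\infty$ off $C$), and $g(\mathbf{z})=\sum_{e\in E}\iota_C(\mathbf{z}_e)$. Unaugmented Lagrangian: $\mathcal{L}_0(\mathbf{x},\mathbf{z},\mathbf{y})=f(\mathbf{x})+g(\mathbf{z})+\mathbf{y}^\top(\mathbf{z}-\mathbf{M}\mathbf{x})$ for $\mathbf{x}\in\mathbb{R}^n$, $\mathbf{z},\mathbf{y}\in\mathbb{R}^{2m}$. A saddle point is a triple $(\mathbf{x}^\star,\mathbf{z}^\star,\mathbf{y}^\star)$ with $\mathcal{L}_0(\mathbf{x}^\star,\mathbf{z}^\star,\mathbf{y})\le \mathcal{L}_0(\mathbf{x}^\star,\mathbf{z}^\star,\mathbf{y}^\star)\le\mathcal{L}_0(\mathbf{x},\mathbf{z},\mathbf{y}^\star)$ for all $(\mathbf{x},\mathbf{z},\mathbf{y})$. Synchronous algorithm: initialize $x_k^0=a_k$ and $y_{e,k}^0=0$ for all $k\in[n]$, $e\in N_k$. For $t=0,1,2,\dots$: (1) for each $e=(i,j)\in E$ set $z_e^{t+1}=(x_i^t+x_j^t)/2$ and $\mathbf{z}_e^{t+1}=z_e^{t+1}\mathbf{1}_2$; (2) for each $k$ and $e\in N_k$ set $y_{e,k}^{t+1}=y_{e,k}^t+\rho(z_e^{t+1}-x_k^t)$; (3) for each $k$ set $x_k^{t+1}=\operatorname{argmin}_{x\in\mathbb{R}}\big\{f_k(x)+\sum_{e\in N_k}\big[y_{e,k}^{t+1}(z_e^{t+1}-x)+\tfrac{\rho}{2}(z_e^{t+1}-x)^2\big]\big\}$.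 Equivalently, $x_k^{t+1}=\operatorname{prox}_{f_k/(\rho d_k)}(\hat z_k^{t+1}+\hat\mu_k^{t+1}/\rho)$ with $\hat z_k=\frac1{d_k}\sum_{e\in N_k}z_e$, $\hat\mu_k=\frac1{d_k}\sum_{e\in N_k}y_{e,k}$ and $\operatorname{prox}_{h}(v)=\operatorname{argmin}_{w}\{h(w)+\tfrac12(w-v)^2\}$. *)

theory Defs
  imports "HOL-Analysis.Analysis"
begin

text \<open>
  The node set \<open>[n]\<close> is a finite type \<open>'n\<close>. An undirected edge \<open>{i, j}\<close> is stored as exactly
  one of the ordered pairs \<open>(i, j)\<close>, \<open>(j, i)\<close>; which one is arbitrary and only fixes the order of
  the two coordinates of the blocks in \<open>\<real>\<^sup>2\<close> belonging to that edge.
\<close>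

text \<open>Taking \<open>i = j\<close> shows that this also excludes loops.\<close>
definition simple_graph :: "('n \<times> 'n) set \<Rightarrow> bool" where
  "simple_graph E \<longleftrightarrow> (\<forall>i j. (i, j) \<in> E \<longrightarrow> (j, i) \<notin> E)"

definition connected_graph :: "('n \<times> 'n) set \<Rightarrow> bool" where
  "connected_graph E \<longleftrightarrow> (\<forall>u v. (u, v) \<in> (E \<union> E\<inverse>)\<^sup>*)"

definition bipartite_graph :: "('n \<times> 'n) set \<Rightarrow> bool" where
  "bipartite_graph E \<longleftrightarrow> (\<exists>S. \<forall>(i, j) \<in> E. (i \<in> S) \<noteq> (j \<in> S))"

definition incident_edges :: "('n \<times> 'n) set \<Rightarrow> 'n \<Rightarrow> ('n \<times> 'n) set" where
  "incident_edges E k = {e \<in> E. k = fst e \<or> k = snd e}"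

text \<open>
  A vector of \<open>\<real>\<^sup>2\<^sup>m\<close> is a family of blocks in \<open>\<real>\<^sup>2\<close> indexed by the edges. Only
  the blocks at edges in \<open>E\<close> are meaningful; every definition below ignores the others.
\<close>
type_synonym 'n edge_vec = "'n \<times> 'n \<Rightarrow> real^2"

definition edge_inner :: "('n \<times> 'n) set \<Rightarrow> 'n edge_vec \<Rightarrow> 'n edge_vec \<Rightarrow> real" where
  "edge_inner E u v = (\<Sum>e\<in>E. u e \<bullet> v e)"

definition edge_norm :: "('n \<times> 'n) set \<Rightarrow> 'n edge_vec \<Rightarrow> real" where
  "edge_norm E u = L2_set (\<lambda>e. norm (u e)) E"

text \<open>The entry \<open>u\<^bsub>e,k\<^esub>\<close> of a block, for an endpoint \<open>k\<close> of \<open>e\<close>.\<close>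
definition edge_coord :: "'n edge_vec \<Rightarrow> 'n \<times> 'n \<Rightarrow> 'n \<Rightarrow> real" where
  "edge_coord u e k = (if k = fst e then u e $ 1 else u e $ 2)"

definition M_block :: "'n::finite \<times> 'n \<Rightarrow> real^'n^2" where
  "M_block e = vector [axis (fst e) 1, axis (snd e) 1]"

lemma M_block_mult: "M_block (i, j) *v x = vector [x $ i, x $ j]"
  by (simp add: M_block_def vec_eq_iff forall_2 matrix_vector_mul_component
      inner_axis')

definition M_stack :: "real^'n::finite \<Rightarrow> 'n edge_vec" where
  "M_stack x = (\<lambda>e. M_block e *v x)"

definition epigraph_ext :: "(real \<Rightarrow> ereal) \<Rightarrow> (real \<times> real) set" where
  "epigraph_ext h = {(w, r). h w \<le> ereal r}"

definition closed_fun :: "(real \<Rightarrow> ereal) \<Rightarrow> bool" where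
  "closed_fun h \<longleftrightarrow> closed (epigraph_ext h)"

definition proper_fun :: "(real \<Rightarrow> ereal) \<Rightarrow> bool" where
  "proper_fun h \<longleftrightarrow> (\<forall>w. h w \<noteq> -\<infinity>) \<and> (\<exists>w. h w \<noteq> \<infinity>)"

definition convex_fun :: "(real \<Rightarrow> ereal) \<Rightarrow> bool" where
  "convex_fun h \<longleftrightarrow> convex (epigraph_ext h)"

definition f_total :: "('n::finite \<Rightarrow> real \<Rightarrow> ereal) \<Rightarrow> real^'n \<Rightarrow> ereal" where
  "f_total f x = (\<Sum>k\<in>UNIV. f k (x $ k))"

definition consensus_line :: "(real^2) set" where
  "consensus_line = span {vec 1}"

definition convex_indicator :: "'a set \<Rightarrow> 'a \<Rightarrow> ereal" where
  "convex_indicator S v = (if v \<in> S then 0 else \<infinity>)"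

definition g_total :: "('n \<times> 'n) set \<Rightarrow> 'n edge_vec \<Rightarrow> ereal" where
  "g_total E z = (\<Sum>e\<in>E. convex_indicator consensus_line (z e))"

definition lagrangian ::
  "('n::finite \<times> 'n) set \<Rightarrow> ('n \<Rightarrow> real \<Rightarrow> ereal) \<Rightarrow> real^'n \<Rightarrow> 'n edge_vec \<Rightarrow> 'n edge_vec \<Rightarrow> ereal"
where
  "lagrangian E f x z y =
     f_total f x + g_total E z + ereal (edge_inner E y (\<lambda>e. z e - M_stack x e))"

definition saddle_point ::
  "('n::finite \<times> 'n) set \<Rightarrow> ('n \<Rightarrow> real \<Rightarrow> ereal) \<Rightarrow> real^'n \<Rightarrow> 'n edge_vec \<Rightarrow> 'n edge_vec \<Rightarrow> bool"
where
  "saddle_point E f xs zs ys \<longleftrightarrow>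
     (\<forall>x z y. lagrangian E f xs zs y \<le> lagrangian E f xs zs ys
            \<and> lagrangian E f xs zs ys \<le> lagrangian E f x z ys)"

definition edge_mean :: "real^'n \<Rightarrow> 'n \<times> 'n \<Rightarrow> real" where
  "edge_mean x e = (x $ fst e + x $ snd e) / 2"

text \<open>The argument \<open>zm\<close> supplies the scalars \<open>z\<^sub>e\<^sup>t\<^sup>+\<^sup>1\<close>.\<close>
definition local_objective ::
  "('n \<times> 'n) set \<Rightarrow> ('n \<Rightarrow> real \<Rightarrow> ereal) \<Rightarrow> real \<Rightarrow> ('n \<times> 'n \<Rightarrow> real) \<Rightarrow> 'n edge_vec \<Rightarrow>
     'n \<Rightarrow> real \<Rightarrow> ereal"
where
  "local_objective E f \<rho> zm y k w =
     f k w + ereal (\<Sum>e\<in>incident_edges E k.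
       edge_coord y e k * (zm e - w) + \<rho> / 2 * (zm e - w)\<^sup>2)"

text \<open>
  The update \<open>x\<^sup>t \<mapsto> x\<^sup>t\<^sup>+\<^sup>1\<close> uses the choice operator \<open>arg_min\<close>, so existence of a minimiser is not
  an assumption on the sequence. The value \<open>z 0\<close> is unconstrained, as the algorithm does not
  initialise \<open>z\<close>.
\<close>
definition sync_sequence ::
  "('n::finite \<times> 'n) set \<Rightarrow> ('n \<Rightarrow> real \<Rightarrow> ereal) \<Rightarrow> real \<Rightarrow> real^'n \<Rightarrow>
     (nat \<Rightarrow> real^'n) \<Rightarrow> (nat \<Rightarrow> 'n edge_vec) \<Rightarrow> (nat \<Rightarrow> 'n edge_vec) \<Rightarrow> bool"
where
  "sync_sequence E f \<rho> a x z y \<longleftrightarrow>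
     (\<forall>k. x 0 $ k = a $ k) \<and>
     (\<forall>k. \<forall>e\<in>incident_edges E k. edge_coord (y 0) e k = 0) \<and>
     (\<forall>t. \<forall>e\<in>E. z (Suc t) e = edge_mean (x t) e *\<^sub>R vec 1) \<and>
     (\<forall>t k. \<forall>e\<in>incident_edges E k.
        edge_coord (y (Suc t)) e k = edge_coord (y t) e k + \<rho> * (edge_mean (x t) e - x t $ k)) \<and>
     (\<forall>t k. x (Suc t) $ k =
        arg_min (local_objective E f \<rho> (edge_mean (x t)) (y (Suc t)) k) (\<lambda>_. True))"

end

theory Submission
  imports Defs
begin

text \<open>
  The dual blocks stay orthogonal to the consensus line, so an edge \<open>e\<close> carries only three scalars:
  \<open>b = y\<^bsub>e,1\<^esub> = - y\<^bsub>e,2\<^esub>\<close>, the mean \<open>s\<close> and the half-difference \<open>d\<close> of the two endpoint values,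
  with \<open>b' = b + \<rho> d\<close>. Adding the subgradient inequality of the primal step at \<open>x\<^sup>\<star>\<close> to the
  saddle-point inequality at the new iterate shows that
  \<open>\<Sum>\<^sub>e ((b - \<beta>)\<^sup>2 / \<rho> + \<rho> (s - \<sigma>)\<^sup>2)\<close>, where \<open>\<beta>\<close> and \<open>\<sigma>\<close> are the saddle-point values of \<open>b\<close> and
  \<open>s\<close>, drops in each step by at least \<open>\<rho> \<Sum>\<^sub>e (d\<^sup>2 + (\<Delta>s)\<^sup>2)\<close>; orthogonality removes the usual cross
  term. Hence \<open>d\<close> and \<open>\<Delta>s\<close> vanish in the limit while \<open>b\<close> and \<open>s\<close> stay bounded, and the same two
  inequalities squeeze the objective values.
\<close>

section \<open>One-dimensional proximal steps: existence and subgradient inequality\<close>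

lemma quadratic_le_bound:
  fixes A b c w :: real
  assumes "A > 0" "A * w\<^sup>2 + b * w + c \<le> 0"
  shows "\<bar>w\<bar> \<le> 1 + (\<bar>b\<bar> + \<bar>c\<bar>) / A"
proof (cases "\<bar>w\<bar> \<le> 1")
  case True
  have "0 \<le> (\<bar>b\<bar> + \<bar>c\<bar>) / A" using assms by simp
  with True show ?thesis by linarith
next
  case False
  have "A * \<bar>w\<bar> * \<bar>w\<bar> = A * w\<^sup>2" by (simp add: power2_eq_square)
  also have "\<dots> \<le> \<bar>b * w\<bar> + \<bar>c\<bar>" using assms(2) by linarith
  also have "\<dots> \<le> \<bar>b\<bar> * \<bar>w\<bar> + \<bar>c\<bar> * \<bar>w\<bar>"
    using False mult_left_mono[of 1 "\<bar>w\<bar>" "\<bar>c\<bar>"] by (simp add: abs_mult)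
  finally have "A * \<bar>w\<bar> * \<bar>w\<bar> \<le> (\<bar>b\<bar> + \<bar>c\<bar>) * \<bar>w\<bar>" by (simp add: algebra_simps)
  then have "A * \<bar>w\<bar> \<le> \<bar>b\<bar> + \<bar>c\<bar>" by (rule mult_right_le_imp_le) (use False in simp)
  then have "\<bar>w\<bar> \<le> (\<bar>b\<bar> + \<bar>c\<bar>) / A" using assms(1) by (simp add: field_simps)
  then show ?thesis by linarith
qed

text \<open>Minimising over points \<open>(w, r)\<close> of the epigraph replaces the
  extended-valued \<open>h\<close> by the coordinate \<open>r\<close>, so the objective becomes
  continuous and closedness of \<open>h\<close> is closedness of the domain. The quadratic growth of
  \<open>q\<close> outweighs the affine minorant, which makes the sublevel set compact.\<close>

lemma prox_minimiser_exists:
  fixes h :: "real \<Rightarrow> ereal"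
  assumes "closed_fun h" "proper_fun h"
    and minorant: "\<And>w. ereal (\<alpha> + \<beta> * w) \<le> h w"
    and "A > 0" and q: "\<And>w. q w = A * w\<^sup>2 + b * w + c"
  shows "\<exists>v. \<forall>w. h v + ereal (q v) \<le> h w + ereal (q w)"
proof -
  obtain w0 r0 where w0: "h w0 = ereal r0"
    using \<open>proper_fun h\<close> unfolding proper_fun_def by (metis ereal_cases)
  define c0 where "c0 = r0 + q w0"
  define S where "S = epigraph_ext h \<inter> {p. snd p + q (fst p) \<le> c0}"
  have cont: "continuous_on X (\<lambda>p. snd p + q (fst p))" for X :: "(real \<times> real) set"
    unfolding q by (intro continuous_intros)
  have "closed S"
    unfolding S_def by (intro closed_Int closed_Collect_le cont continuous_on_const)
      (use \<open>closed_fun h\<close> in \<open>simp add: closed_fun_def\<close>)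
  moreover have "bounded S"
  proof -
    \<comment> \<open>On \<open>S\<close> the quadratic plus the minorant is at most
      \<open>c0\<close>; \<open>K\<close> is the root bound of \<open>quadratic_le_bound\<close> for
      that inequality.\<close>
    define K where "K = 1 + (\<bar>b + \<beta>\<bar> + \<bar>c + \<alpha> - c0\<bar>) / A"
    have "p \<in> {-K..K} \<times> {\<alpha> - \<bar>\<beta>\<bar> * K..c0 + \<bar>b\<bar> * K - c}" if "p \<in> S" for p
    proof -
      obtain w r where p: "p = (w, r)" by (cases p)
      have hw: "h w \<le> ereal r" and le: "r + q w \<le> c0"
        using that by (auto simp: S_def epigraph_ext_def p)
      have r: "\<alpha> + \<beta> * w \<le> r" using order_trans[OF minorant hw] by simp
      have "A * w\<^sup>2 + (b + \<beta>) * w + (c + \<alpha> - c0) \<le> 0"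
        using le r by (simp add: q algebra_simps)
      then have wK: "\<bar>w\<bar> \<le> K"
        unfolding K_def by (rule quadratic_le_bound[OF \<open>A > 0\<close>])
      have "\<bar>\<beta> * w\<bar> \<le> \<bar>\<beta>\<bar> * K" "\<bar>b * w\<bar> \<le> \<bar>b\<bar> * K"
        using wK by (auto simp: abs_mult intro: mult_left_mono)
      moreover have "0 \<le> A * w\<^sup>2" using \<open>A > 0\<close> by simp
      ultimately show ?thesis using r le wK by (simp add: p q) linarith
    qed
    then show ?thesis
      by (intro bounded_subset[OF bounded_Times[OF bounded_closed_interval bounded_closed_interval]])
         blast
  qed
  ultimately have "compact S" by (simp add: compact_eq_bounded_closed)
  moreover have "(w0, r0) \<in> S" by (simp add: S_def epigraph_ext_def w0 c0_def)
  ultimately obtain p where p: "p \<in> S"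
    and min: "\<And>p'. p' \<in> S \<Longrightarrow> snd p + q (fst p) \<le> snd p' + q (fst p')"
    using continuous_attains_inf[of S "\<lambda>p. snd p + q (fst p)"] cont by blast
  have hp: "h (fst p) \<le> ereal (snd p)" and pc0: "snd p + q (fst p) \<le> c0"
    using p by (auto simp: S_def epigraph_ext_def)
  have "h (fst p) + ereal (q (fst p)) \<le> h w + ereal (q w)" for w
  proof (cases "h w")
    case (real r)
    have "snd p + q (fst p) \<le> r + q w"
    proof (cases "r + q w \<le> c0")
      case True
      then show ?thesis using min[of "(w, r)"] by (simp add: S_def epigraph_ext_def real)
    qed (use pc0 in linarith)
    then have "ereal (snd p) + ereal (q (fst p)) \<le> h w + ereal (q w)" by (simp add: real)
    then show ?thesis using add_right_mono[OF hp] order_trans by blast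
  next
    case MInf
    then show ?thesis using minorant[of w] by simp
  qed simp
  then show ?thesis by blast
qed

text \<open>Since \<open>g\<close> is the slope of \<open>q\<close> at \<open>v\<close>, this says
  that \<open>- g\<close> is a subgradient of \<open>h\<close> at \<open>v\<close>. Minimality is
  tested at points of the segment from \<open>v\<close> to \<open>w\<close>, where convexity bounds
  \<open>h\<close>; dividing by \<open>\<theta>\<close> leaves the quadratic term with a factor
  \<open>\<theta>\<close> that vanishes in the limit.\<close>

lemma minimiser_subgradient:
  fixes h :: "real \<Rightarrow> ereal"
  assumes "convex_fun h" "h v = ereal p" "h w = ereal r"
    and min: "\<And>u. h v + ereal (q v) \<le> h u + ereal (q u)"
    and q: "\<And>u. q u = q v + g * (u - v) + A * (u - v)\<^sup>2"
  shows "p - g * (w - v) \<le> r"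
proof -
  have "p - r - g * (w - v) \<le> \<theta> * (A * (w - v)\<^sup>2)" if "0 < \<theta>" "\<theta> < 1" for \<theta> :: real
  proof -
    have "(1 - \<theta>) *\<^sub>R (v, p) + \<theta> *\<^sub>R (w, r) \<in> epigraph_ext h"
      using assms(1-3) that unfolding convex_fun_def
      by (intro convexD) (auto simp: epigraph_ext_def)
    then have "h ((1 - \<theta>) * v + \<theta> * w) \<le> ereal ((1 - \<theta>) * p + \<theta> * r)"
      by (simp add: epigraph_ext_def)
    from order_trans[OF min add_right_mono[OF this]]
    have "p + q v \<le> (1 - \<theta>) * p + \<theta> * r + q ((1 - \<theta>) * v + \<theta> * w)"
      by (simp add: \<open>h v = ereal p\<close>)
    also have "q ((1 - \<theta>) * v + \<theta> * w) = q v + \<theta> * (g * (w - v)) + \<theta> * (\<theta> * (A * (w - v)\<^sup>2))"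
      unfolding q[of "(1 - \<theta>) * v + \<theta> * w"] by (simp add: power2_eq_square algebra_simps)
    finally have "\<theta> * (p - r - g * (w - v)) \<le> \<theta> * (\<theta> * (A * (w - v)\<^sup>2))"
      by (simp add: algebra_simps)
    then show ?thesis using that by simp
  qed
  then have "\<forall>\<^sub>F \<theta> in at_right 0. p - r - g * (w - v) \<le> \<theta> * (A * (w - v)\<^sup>2)"
    using eventually_at_right_less[of "0::real"] eventually_at_right_real[of 0 "1::real"]
    by (auto elim: eventually_elim2)
  moreover have "((\<lambda>\<theta>::real. \<theta> * (A * (w - v)\<^sup>2)) \<longlongrightarrow> 0 * (A * (w - v)\<^sup>2)) (at_right 0)"
    by (intro tendsto_intros)
  ultimately have "p - r - g * (w - v) \<le> 0 * (A * (w - v)\<^sup>2)"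
    by (intro tendsto_lowerbound) auto
  then show ?thesis by simp
qed

section \<open>Lyapunov argument for scalar edge sequences\<close>

text \<open>A decreasing sequence bounded below converges, so its decrements, which dominate
  \<open>R\<close>, tend to zero.\<close>

lemma lyapunov_decrease_tendsto_zero:
  fixes W R :: "nat \<Rightarrow> real"
  assumes "\<And>t. 0 \<le> W t" "\<And>t. 0 \<le> R t" "\<And>t. W (Suc t) + R t \<le> W t"
  shows "R \<longlonglongrightarrow> 0"
proof -
  have "W (Suc t) \<le> W t" for t using assms(2)[of t] assms(3)[of t] by linarith
  then have "decseq W" by (rule decseq_SucI)
  then obtain L where L: "W \<longlonglongrightarrow> L" using decseq_convergent[of W 0] assms(1) by metis
  have "(\<lambda>t. W t - W (Suc t)) \<longlonglongrightarrow> L - L" using L by (intro tendsto_diff LIMSEQ_Suc)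
  then have "(\<lambda>t. W t - W (Suc t)) \<longlonglongrightarrow> 0" by simp
  moreover have "R t \<le> W t - W (Suc t)" for t using assms(3)[of t] by simp
  ultimately show ?thesis
    using assms(2) by (intro Lim_null_comparison[of R "\<lambda>t. W t - W (Suc t)"]) auto
qed

lemma sum_nonneg_tendsto_zeroD:
  fixes g :: "nat \<Rightarrow> 'e \<Rightarrow> real"
  assumes "finite E" "e \<in> E" "\<And>t e. 0 \<le> g t e" "(\<lambda>t. \<Sum>e\<in>E. g t e) \<longlonglongrightarrow> 0"
  shows "(\<lambda>t. g t e) \<longlonglongrightarrow> 0"
  by (rule Lim_null_comparison[OF _ assms(4)])
     (use assms in \<open>auto intro!: member_le_sum always_eventually\<close>)

text \<open>The iteration with graph and cost functions stripped away: \<open>upper\<close> stands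
  for the summed subgradient inequality and \<open>lower\<close> for the saddle-point inequality.
  Both start at index \<open>Suc t\<close>, since the initial point may have infinite cost.\<close>

lemma scalar_admm_convergence:
  fixes b s d :: "nat \<Rightarrow> 'e \<Rightarrow> real" and \<beta> \<sigma> :: "'e \<Rightarrow> real" and \<phi> :: "nat \<Rightarrow> real"
  assumes "finite E" "\<rho> > 0"
    and b: "\<And>t e. e \<in> E \<Longrightarrow> b (Suc t) e = b t e + \<rho> * d t e"
    and upper: "\<And>t. \<phi> (Suc t) + 2 * (\<Sum>e\<in>E. b (Suc (Suc t)) e * d (Suc t) e
          + \<rho> * (s (Suc t) e - s t e) * (s (Suc t) e - \<sigma> e)) \<le> \<phi>s"
    and lower: "\<And>t. \<phi>s - 2 * (\<Sum>e\<in>E. \<beta> e * d (Suc t) e) \<le> \<phi> (Suc t)"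
  shows "\<And>e. e \<in> E \<Longrightarrow> (\<lambda>t. d t e) \<longlonglongrightarrow> 0"
    and "\<And>e. e \<in> E \<Longrightarrow> (\<lambda>t. s (Suc t) e - s t e) \<longlonglongrightarrow> 0"
    and "\<phi> \<longlonglongrightarrow> \<phi>s"
proof -
  \<comment> \<open>The multiplier computed from iterate \<open>t\<close> is
    \<open>b (Suc t)\<close>, so it is paired with \<open>s t\<close>.\<close>
  define W where "W t = (\<Sum>e\<in>E. (b (Suc t) e - \<beta> e)\<^sup>2 / \<rho> + \<rho> * (s t e - \<sigma> e)\<^sup>2)" for t
  define R where "R t = (\<Sum>e\<in>E. \<rho> * (d (Suc t) e)\<^sup>2 + \<rho> * (s (Suc t) e - s t e)\<^sup>2)" for t
  have W0: "0 \<le> W t" and R0: "0 \<le> R t" for t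
    using \<open>\<rho> > 0\<close> by (auto simp: W_def R_def intro!: sum_nonneg)
  have dec: "W (Suc t) + R t \<le> W t" for t
  proof -
    \<comment> \<open>Each difference of squares expands as
      \<open>u^2 - v^2 = 2 * u * (u - v) - (u - v)^2\<close>; the subtracted squares are exactly the
      terms of \<open>R\<close>.\<close>
    have "W (Suc t) + R t - W t = 2 * (\<Sum>e\<in>E. b (Suc (Suc t)) e * d (Suc t) e
          + \<rho> * (s (Suc t) e - s t e) * (s (Suc t) e - \<sigma> e)) - 2 * (\<Sum>e\<in>E. \<beta> e * d (Suc t) e)"
      unfolding W_def R_def sum_distrib_left sum.distrib[symmetric] sum_subtractf[symmetric]
      by (rule sum.cong) (use \<open>\<rho> > 0\<close> in \<open>simp_all add: b field_simps power2_eq_square\<close>)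
    also have "\<dots> \<le> 0" using upper[of t] lower[of t] by linarith
    finally show ?thesis by simp
  qed
  have R: "R \<longlonglongrightarrow> 0" by (rule lyapunov_decrease_tendsto_zero[where W = W]) (fact W0 R0 dec)+
  have term0: "(\<lambda>t. \<rho> * (d (Suc t) e)\<^sup>2 + \<rho> * (s (Suc t) e - s t e)\<^sup>2) \<longlonglongrightarrow> 0" if "e \<in> E" for e
    by (rule sum_nonneg_tendsto_zeroD[OF \<open>finite E\<close> that])
       (use R[unfolded R_def] \<open>\<rho> > 0\<close> in simp_all)
  have sq0: "(\<lambda>t. u t) \<longlonglongrightarrow> 0" if "e \<in> E"
    "\<And>t. \<rho> * (u t)\<^sup>2 \<le> \<rho> * (d (Suc t) e)\<^sup>2 + \<rho> * (s (Suc t) e - s t e)\<^sup>2" for e and u :: "nat \<Rightarrow> real"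
  proof -
    have "(\<lambda>t. \<rho> * (u t)\<^sup>2) \<longlonglongrightarrow> 0"
      by (rule Lim_null_comparison[OF _ term0[OF that(1)]])
         (use that(2) \<open>\<rho> > 0\<close> in \<open>auto intro!: always_eventually\<close>)
    then show ?thesis using \<open>\<rho> > 0\<close> by (simp add: tendsto_mult_left_iff)
  qed
  have d0: "(\<lambda>t. d (Suc t) e) \<longlonglongrightarrow> 0" if "e \<in> E" for e
    by (rule sq0[OF that]) (use \<open>\<rho> > 0\<close> in simp)
  show d: "(\<lambda>t. d t e) \<longlonglongrightarrow> 0" if "e \<in> E" for e
    by (rule LIMSEQ_imp_Suc[OF d0[OF that]])
  show s: "(\<lambda>t. s (Suc t) e - s t e) \<longlonglongrightarrow> 0" if "e \<in> E" for e
    by (rule sq0[OF that]) (use \<open>\<rho> > 0\<close> in simp)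
  have WW: "W t \<le> W 0" for t
  proof (induction t)
    case (Suc t)
    then show ?case using dec[of t] R0[of t] by linarith
  qed simp
  have edgeW: "(b (Suc t) e - \<beta> e)\<^sup>2 / \<rho> + \<rho> * (s t e - \<sigma> e)\<^sup>2 \<le> W 0" if "e \<in> E" for e t
    using WW[of t] \<open>\<rho> > 0\<close>
      member_le_sum[of e E "\<lambda>e. (b (Suc t) e - \<beta> e)\<^sup>2 / \<rho> + \<rho> * (s t e - \<sigma> e)\<^sup>2"] that \<open>finite E\<close>
    unfolding W_def by (smt (verit) divide_nonneg_pos mult_nonneg_nonneg zero_le_power2)
  \<comment> \<open>Each edge term of \<open>W\<close> stays below \<open>W 0\<close>. The resulting
    bounds suffice because \<open>b\<close> and \<open>s - \<sigma>\<close> enter the upper estimate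
    only multiplied by null sequences.\<close>
  have Bs: "Bfun (\<lambda>t. s t e - \<sigma> e) sequentially" and Bb: "Bfun (\<lambda>t. b (Suc t) e) sequentially"
    if "e \<in> E" for e
  proof -
    have "\<rho> * (s t e - \<sigma> e)\<^sup>2 \<le> W 0" for t
      using edgeW[OF that, of t] \<open>\<rho> > 0\<close> by (smt (verit) divide_nonneg_pos zero_le_power2)
    then have "\<bar>s t e - \<sigma> e\<bar> \<le> sqrt (W 0 / \<rho>)" for t
      using \<open>\<rho> > 0\<close> by (intro real_le_rsqrt) (simp add: field_simps)
    then show "Bfun (\<lambda>t. s t e - \<sigma> e) sequentially"
      by (intro BfunI[where K = "sqrt (W 0 / \<rho>)"]) (auto intro!: always_eventually)
    have "(b (Suc t) e - \<beta> e)\<^sup>2 / \<rho> \<le> W 0" for t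
      using edgeW[OF that, of t] \<open>\<rho> > 0\<close> by (smt (verit) mult_nonneg_nonneg zero_le_power2)
    then have bW: "\<bar>b (Suc t) e - \<beta> e\<bar> \<le> sqrt (W 0 * \<rho>)" for t
      using \<open>\<rho> > 0\<close> by (intro real_le_rsqrt) (simp add: field_simps)
    have "\<bar>b (Suc t) e\<bar> \<le> sqrt (W 0 * \<rho>) + \<bar>\<beta> e\<bar>" for t
      using bW[of t] by linarith
    then show "Bfun (\<lambda>t. b (Suc t) e) sequentially"
      by (intro BfunI[where K = "sqrt (W 0 * \<rho>) + \<bar>\<beta> e\<bar>"]) (auto intro!: always_eventually)
  qed
  have bd: "(\<lambda>t. b (Suc (Suc t)) e * d (Suc t) e) \<longlonglongrightarrow> 0" if "e \<in> E" for e
  proof -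
    have "(\<lambda>t. b (Suc t) e * d t e) \<longlonglongrightarrow> 0"
      using bounded_bilinear.Bfun_prod_Zfun[OF bounded_bilinear_mult Bb[OF that]] d[OF that]
      by (simp add: tendsto_Zfun_iff)
    from LIMSEQ_Suc[OF this] show ?thesis .
  qed
  have ss: "(\<lambda>t. (s (Suc t) e - s t e) * (s (Suc t) e - \<sigma> e)) \<longlonglongrightarrow> 0" if "e \<in> E" for e
  proof -
    have "Bfun (\<lambda>t. s (Suc t) e - \<sigma> e) sequentially"
      using Bs[OF that] Bseq_Suc_iff[of "\<lambda>t. s t e - \<sigma> e"] by blast
    from bounded_bilinear.Zfun_prod_Bfun[OF bounded_bilinear_mult _ this] s[OF that]
    show ?thesis by (simp add: tendsto_Zfun_iff)
  qed
  define U where "U t = \<phi>s - 2 * (\<Sum>e\<in>E. b (Suc (Suc t)) e * d (Suc t) e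
      + \<rho> * ((s (Suc t) e - s t e) * (s (Suc t) e - \<sigma> e)))" for t
  define L where "L t = \<phi>s - 2 * (\<Sum>e\<in>E. \<beta> e * d (Suc t) e)" for t
  have U: "U \<longlonglongrightarrow> \<phi>s - 2 * (\<Sum>e\<in>E. 0 + \<rho> * 0)"
    unfolding U_def by (intro tendsto_intros bd ss)
  have L: "L \<longlonglongrightarrow> \<phi>s - 2 * (\<Sum>e\<in>E. \<beta> e * 0)"
    unfolding L_def by (intro tendsto_intros d0)
  have "L t \<le> \<phi> (Suc t)" "\<phi> (Suc t) \<le> U t" for t
    using lower[of t] upper[of t] by (simp_all add: L_def U_def mult.assoc)
  then have "(\<lambda>t. \<phi> (Suc t)) \<longlonglongrightarrow> \<phi>s"
    using tendsto_sandwich[OF _ _ L, of "\<lambda>t. \<phi> (Suc t)" U] U by simp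
  then show "\<phi> \<longlonglongrightarrow> \<phi>s" by (rule LIMSEQ_imp_Suc)
qed


section \<open>Graph sums and the local quadratic\<close>

text \<open>The sign is chosen so that the mean minus the value at \<open>fst e\<close> is
  \<open>edge_diff\<close>, which makes the first dual coordinate grow by
  \<open>+ \<rho> * edge_diff\<close>.\<close>

definition edge_diff :: "real^'n \<Rightarrow> 'n \<times> 'n \<Rightarrow> real" where
  "edge_diff w e = (w $ snd e - w $ fst e) / 2"

lemma M_stack_component:
  "M_stack w e $ 1 = w $ fst e" "M_stack w e $ 2 = w $ snd e"
  by (cases e; simp add: M_stack_def M_block_mult)+

text \<open>Double counting: the absence of loops makes the two endpoints distinct, so the incidence
  condition splits into two disjoint indicators.\<close>

lemma sum_incident_edges:
  fixes E :: "('n::finite \<times> 'n) set" and c :: "'n \<times> 'n \<Rightarrow> 'n \<Rightarrow> real"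
  assumes "simple_graph E"
  shows "(\<Sum>k\<in>UNIV. \<Sum>e\<in>incident_edges E k. c e k) = (\<Sum>e\<in>E. c e (fst e) + c e (snd e))"
proof -
  have ne: "fst e \<noteq> snd e" if "e \<in> E" for e
    using assms that unfolding simple_graph_def by (metis prod.collapse)
  have "(\<Sum>k\<in>UNIV. \<Sum>e\<in>incident_edges E k. c e k)
      = (\<Sum>k\<in>UNIV. \<Sum>e\<in>E. if k = fst e \<or> k = snd e then c e k else 0)"
    unfolding incident_edges_def by (intro sum.cong sum.inter_filter) auto
  also have "\<dots> = (\<Sum>e\<in>E. \<Sum>k\<in>UNIV. if k = fst e \<or> k = snd e then c e k else 0)"
    by (rule sum.swap)
  also have "\<dots> = (\<Sum>e\<in>E. \<Sum>k\<in>UNIV. (if k = fst e then c e k else 0) + (if k = snd e then c e k else 0))"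
    by (intro sum.cong refl) (metis add.left_neutral add.right_neutral ne)
  also have "\<dots> = (\<Sum>e\<in>E. c e (fst e) + c e (snd e))"
    by (simp add: sum.distrib)
  finally show ?thesis .
qed

text \<open>The first step of a path to another node. Positive degree gives the local quadratic a
  positive leading coefficient.\<close>

lemma incident_edges_nonempty:
  fixes E :: "('n::finite \<times> 'n) set"
  assumes "CARD('n) \<ge> 2" "connected_graph E"
  shows "incident_edges E k \<noteq> {}"
proof -
  have "UNIV \<noteq> {k}"
  proof
    assume "UNIV = {k}"
    then have "CARD('n) = card {k}" by (rule arg_cong)
    then show False using assms(1) by simp
  qed
  then obtain u where "u \<noteq> k" by blast
  moreover have "(k, u) \<in> (E \<union> E\<inverse>)\<^sup>*" using assms(2) by (simp add: connected_graph_def)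
  ultimately obtain v where "(k, v) \<in> E \<union> E\<inverse>" by (metis converse_rtranclE)
  then show ?thesis unfolding incident_edges_def by force
qed

text \<open>Exact second-order Taylor expansion at \<open>v\<close>. It serves at
  \<open>v = 0\<close> for the existence of a minimiser and at the minimiser itself for the
  subgradient.\<close>

lemma local_quadratic_expansion:
  fixes Y \<zeta> :: "'e \<Rightarrow> real"
  shows "(\<Sum>e\<in>N. Y e * (\<zeta> e - u) + \<rho> / 2 * (\<zeta> e - u)\<^sup>2) =
      (\<Sum>e\<in>N. Y e * (\<zeta> e - v) + \<rho> / 2 * (\<zeta> e - v)\<^sup>2)
      + - (\<Sum>e\<in>N. Y e + \<rho> * (\<zeta> e - v)) * (u - v) + (\<rho> / 2 * real (card N)) * (u - v)\<^sup>2"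
proof -
  have "(\<rho> / 2 * real (card N)) * (u - v)\<^sup>2 = (\<Sum>e\<in>N. \<rho> / 2 * (u - v)\<^sup>2)" by simp
  then show ?thesis
    unfolding sum_negf[symmetric] sum_distrib_right
    by (simp only: sum.distrib[symmetric])
       (rule sum.cong, simp_all add: field_simps power2_eq_square)
qed

lemma arg_min_le:
  fixes h :: "'a \<Rightarrow> 'b::linorder"
  assumes "\<exists>v. \<forall>w. h v \<le> h w"
  shows "h (arg_min h (\<lambda>_. True)) \<le> h w"
proof -
  have "\<exists>v. is_arg_min h (\<lambda>_. True) v" using assms by (auto simp: is_arg_min_def not_less)
  then have "is_arg_min h (\<lambda>_. True) (arg_min h (\<lambda>_. True))"
    unfolding arg_min_def by (rule someI_ex)
  then show ?thesis by (simp add: is_arg_min_linorder)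
qed

section \<open>Consequences of the saddle-point condition\<close>

lemma g_total_eq:
  fixes E :: "('n::finite \<times> 'n) set"
  shows "g_total E z = (if \<forall>e\<in>E. z e \<in> consensus_line then 0 else \<infinity>)"
  unfolding g_total_def convex_indicator_def by (auto simp: sum_Pinfty)

lemma f_total_eq_ereal:
  assumes "\<And>k. f k (w $ k) = ereal (p k)"
  shows "f_total f w = ereal (\<Sum>k\<in>UNIV. p k)"
  unfolding f_total_def by (simp add: assms)

text \<open>Properness supplies a point of finite cost; together with \<open>z = 0\<close> it bounds
  the saddle value away from \<open>\<infinity>\<close>, so no summand there can be
  infinite.\<close>

lemma saddle_point_finite:
  assumes proper: "\<And>k. proper_fun (f k)" and saddle: "saddle_point E f xs zs ys"
  shows "f k (xs $ k) = ereal (real_of_ereal (f k (xs $ k)))" and "\<forall>e\<in>E. zs e \<in> consensus_line"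
proof -
  have nM: "f k v \<noteq> -\<infinity>" for k v using proper unfolding proper_fun_def by blast
  have "\<exists>v r. f k v = ereal r" for k
    using proper[of k] unfolding proper_fun_def by (metis ereal_cases)
  then obtain v r where v: "\<And>k. f k (v k) = ereal (r k)" by metis
  have "f_total f (\<chi> k. v k) = ereal (\<Sum>k\<in>UNIV. r k)"
    by (rule f_total_eq_ereal) (simp add: v)
  moreover have "g_total E (\<lambda>_. 0) = 0"
    by (simp add: g_total_eq consensus_line_def span_zero)
  ultimately have "lagrangian E f (\<chi> k. v k) (\<lambda>_. 0) ys < \<infinity>"
    by (simp add: lagrangian_def)
  then have fin: "lagrangian E f xs zs ys < \<infinity>"
    using saddle unfolding saddle_point_def by (metis le_less_trans)
  have "f_total f xs \<noteq> -\<infinity>"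
  proof
    assume *: "f_total f xs = -\<infinity>"
    then have "\<bar>\<Sum>k\<in>UNIV. f k (xs $ k)\<bar> = \<infinity>" by (simp add: f_total_def)
    then obtain k where "\<bar>f k (xs $ k)\<bar> = \<infinity>" unfolding sum_Inf by (elim conjE bexE)
    then have "f k (xs $ k) = \<infinity>" using nM[of k "xs $ k"] by auto
    then have "f_total f xs = \<infinity>" unfolding f_total_def by (auto simp: sum_Pinfty)
    with * show False by simp
  qed
  moreover have "g_total E zs \<noteq> -\<infinity>" by (simp add: g_total_eq)
  ultimately have "f_total f xs \<noteq> \<infinity>" and g: "g_total E zs \<noteq> \<infinity>"
    using fin by (auto simp: lagrangian_def)
  then have "f k (xs $ k) \<noteq> \<infinity>" unfolding f_total_def by (auto simp: sum_Pinfty)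
  with nM show "f k (xs $ k) = ereal (real_of_ereal (f k (xs $ k)))"
    by (cases "f k (xs $ k)") auto
  show "\<forall>e\<in>E. zs e \<in> consensus_line" using g by (simp add: g_total_eq split: if_splits)
qed

text \<open>Three test points extract primal feasibility, orthogonality of the multiplier to the
  consensus line, and optimality in \<open>x\<close>.\<close>

lemma saddle_point_KKT:
  fixes E :: "('n::finite \<times> 'n) set"
  assumes proper: "\<And>k. proper_fun (f k)" and saddle: "saddle_point E f xs zs ys"
  shows "\<And>e. e \<in> E \<Longrightarrow> xs $ fst e = xs $ snd e"
    and "f_total f xs \<le> f_total f w + ereal (2 * (\<Sum>e\<in>E. ys e $ 1 * edge_diff w e))"
proof -
  note fin = saddle_point_finite[OF assms]
  define p where "p k = real_of_ereal (f k (xs $ k))" for k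
  have p: "f k (xs $ k) = ereal (p k)" for k unfolding p_def by (rule fin(1))
  define \<phi>s where "\<phi>s = (\<Sum>k\<in>UNIV. p k)"
  have fs: "f_total f xs = ereal \<phi>s" unfolding \<phi>s_def by (rule f_total_eq_ereal) (rule p)
  have gs: "g_total E zs = 0" using fin(2) by (simp add: g_total_eq)
  define r where "r e = zs e - M_stack xs e" for e
  \<comment> \<open>Moving the multiplier along the residual adds the squared norm of the residual
    to the Lagrangian.\<close>
  have "lagrangian E f xs zs (\<lambda>e. ys e + r e) \<le> lagrangian E f xs zs ys"
    using saddle unfolding saddle_point_def by blast
  then have "(\<Sum>e\<in>E. r e \<bullet> r e) \<le> 0"
    by (simp add: lagrangian_def fs gs edge_inner_def r_def[symmetric] inner_add_left sum.distrib)
  then have "(\<Sum>e\<in>E. r e \<bullet> r e) = 0" by (intro antisym sum_nonneg) auto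
  then have r0: "r e = 0" if "e \<in> E" for e
    using that by (subst (asm) sum_nonneg_eq_0_iff) auto
  show cons: "xs $ fst e = xs $ snd e" if e: "e \<in> E" for e
  proof -
    obtain c where "zs e = c *\<^sub>R vec 1"
      using fin(2) e unfolding consensus_line_def span_singleton by blast
    then have "M_stack xs e = c *\<^sub>R vec 1" using r0[OF e] by (simp add: r_def)
    then have "M_stack xs e $ 1 = M_stack xs e $ 2" by simp
    then show ?thesis by (simp add: M_stack_component)
  qed
  have Ls: "lagrangian E f xs zs ys = ereal \<phi>s"
    using r0 by (simp add: lagrangian_def fs gs edge_inner_def r_def[symmetric])
  have ineq: "ereal \<phi>s \<le> f_total f w + ereal (\<Sum>e\<in>E. ys e \<bullet> (z e - M_stack w e))"
    if "\<forall>e\<in>E. z e \<in> consensus_line" for w z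
  proof -
    have "lagrangian E f xs zs ys \<le> lagrangian E f w z ys"
      using saddle unfolding saddle_point_def by blast
    then show ?thesis unfolding Ls using that by (simp add: lagrangian_def g_total_eq edge_inner_def)
  qed
  \<comment> \<open>A shift along the consensus line is free for \<open>g_total\<close>; this one
    lowers the linear term by the square of the component to be eliminated.\<close>
  have "\<forall>e\<in>E. zs e - (ys e \<bullet> vec 1) *\<^sub>R vec 1 \<in> consensus_line"
    using fin(2) unfolding consensus_line_def
    by (intro ballI span_diff) (blast, intro span_scale span_base singletonI)
  from ineq[OF this, of xs]
  have "0 \<le> (\<Sum>e\<in>E. ys e \<bullet> (r e - (ys e \<bullet> vec 1) *\<^sub>R vec 1))"
    by (simp add: fs r_def algebra_simps)
  also have "\<dots> = - (\<Sum>e\<in>E. (ys e \<bullet> vec 1)\<^sup>2)"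
    unfolding sum_negf[symmetric] by (rule sum.cong) (simp_all add: r0 power2_eq_square)
  finally have "(\<Sum>e\<in>E. (ys e \<bullet> vec 1)\<^sup>2) = 0" by (intro antisym sum_nonneg) auto
  then have orth: "ys e \<bullet> vec 1 = 0" if "e \<in> E" for e
    using that by (subst (asm) sum_nonneg_eq_0_iff) auto
  have anti: "ys e $ 2 = - ys e $ 1" if "e \<in> E" for e
    using orth[OF that] by (simp add: inner_vec_def sum_2)
  have "(\<Sum>e\<in>E. ys e \<bullet> (0 - M_stack w e)) = 2 * (\<Sum>e\<in>E. ys e $ 1 * edge_diff w e)"
    unfolding sum_distrib_left
    by (rule sum.cong)
       (simp_all add: inner_vec_def sum_2 M_stack_component anti edge_diff_def algebra_simps)
  with ineq[of "\<lambda>_. 0" w]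
  show "f_total f xs \<le> f_total f w + ereal (2 * (\<Sum>e\<in>E. ys e $ 1 * edge_diff w e))"
    by (simp add: fs consensus_line_def span_zero)
qed

text \<open>
  Varying a single coordinate in the saddle-point inequality gives each \<open>f\<^sub>k\<close> an affine minorant,
  so existence of the proximal points needs no separation theorem.
\<close>
lemma saddle_point_affine_minorant:
  fixes E :: "('n::finite \<times> 'n) set"
  assumes proper: "\<And>k. proper_fun (f k)" and saddle: "saddle_point E f xs zs ys"
  shows "\<exists>\<alpha> \<beta>. \<forall>v. ereal (\<alpha> + \<beta> * v) \<le> f k v"
proof -
  define p where "p j = real_of_ereal (f j (xs $ j))" for j
  have p: "f j (xs $ j) = ereal (p j)" for j
    unfolding p_def by (rule saddle_point_finite(1)[OF assms])
  define G where "G w = 2 * (\<Sum>e\<in>E. ys e $ 1 * edge_diff w e)" for w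
  have G: "G (xs + c *\<^sub>R axis k 1) = G xs + c * G (axis k 1)" for c
    unfolding G_def sum_distrib_left sum.distrib[symmetric]
    by (rule sum.cong) (simp_all add: edge_diff_def field_simps)
  have fs: "f_total f xs = ereal (\<Sum>j\<in>UNIV. p j)" by (rule f_total_eq_ereal) (rule p)
  have "ereal (p k - G xs + xs $ k * G (axis k 1) + - G (axis k 1) * v) \<le> f k v" for v
  proof (cases "f k v")
    case (real r)
    define w where "w = xs + (v - xs $ k) *\<^sub>R axis k 1"
    have "f_total f w = ereal (\<Sum>j\<in>UNIV. if j = k then r else p j)"
      by (rule f_total_eq_ereal) (auto simp: w_def axis_def real p)
    also have "(\<Sum>j\<in>UNIV. if j = k then r else p j) = (\<Sum>j\<in>UNIV. p j) + (r - p k)"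
      by (simp add: sum.remove[of UNIV k])
    finally have "(\<Sum>j\<in>UNIV. p j) \<le> (\<Sum>j\<in>UNIV. p j) + (r - p k) + G w"
      using saddle_point_KKT(2)[OF assms, of w] by (simp add: fs G_def)
    then show ?thesis unfolding w_def G by (simp add: real algebra_simps)
  next
    case MInf
    then show ?thesis using proper[of k] by (simp add: proper_fun_def)
  qed simp
  then show ?thesis by blast
qed

section \<open>The primal and dual updates of the algorithm\<close>

lemma local_objective_minimiser_exists:
  fixes E :: "('n::finite \<times> 'n) set"
  assumes "closed_fun (f k)" "proper_fun (f k)" "\<And>v. ereal (\<alpha> + \<beta> * v) \<le> f k v"
    and "\<rho> > 0" "incident_edges E k \<noteq> {}"
  shows "\<exists>v. \<forall>w. local_objective E f \<rho> \<zeta> Y k v \<le> local_objective E f \<rho> \<zeta> Y k w"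
proof -
  define q where "q w = (\<Sum>e\<in>incident_edges E k.
      edge_coord Y e k * (\<zeta> e - w) + \<rho> / 2 * (\<zeta> e - w)\<^sup>2)" for w
  define A where "A = \<rho> / 2 * real (card (incident_edges E k))"
  define g where "g = - (\<Sum>e\<in>incident_edges E k. edge_coord Y e k + \<rho> * (\<zeta> e - 0))"
  have "A > 0" using assms(4,5) by (simp add: A_def card_gt_0_iff)
  moreover have "q w = A * w\<^sup>2 + g * w + q 0" for w
    using local_quadratic_expansion[of _ \<zeta> w \<rho> _ 0] by (simp add: A_def g_def q_def)
  ultimately have "\<exists>v. \<forall>w. f k v + ereal (q v) \<le> f k w + ereal (q w)"
    by (rule prox_minimiser_exists[OF assms(1-3)])
  then show ?thesis by (simp add: local_objective_def q_def)
qed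

lemma local_objective_subgradient:
  fixes E :: "('n::finite \<times> 'n) set"
  assumes "convex_fun (f k)" "f k v = ereal p" "f k w = ereal r"
    and "\<And>u. local_objective E f \<rho> \<zeta> Y k v \<le> local_objective E f \<rho> \<zeta> Y k u"
  shows "p + (\<Sum>e\<in>incident_edges E k. (edge_coord Y e k + \<rho> * (\<zeta> e - v)) * (w - v)) \<le> r"
proof -
  define q where "q u = (\<Sum>e\<in>incident_edges E k.
      edge_coord Y e k * (\<zeta> e - u) + \<rho> / 2 * (\<zeta> e - u)\<^sup>2)" for u
  have "p - - (\<Sum>e\<in>incident_edges E k. edge_coord Y e k + \<rho> * (\<zeta> e - v)) * (w - v) \<le> r"
  proof (rule minimiser_subgradient[where q = q])
    show "f k v + ereal (q v) \<le> f k u + ereal (q u)" for u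
      using assms(4)[of u] by (simp add: local_objective_def q_def)
    show "q u = q v + - (\<Sum>e\<in>incident_edges E k. edge_coord Y e k + \<rho> * (\<zeta> e - v)) * (u - v)
        + (\<rho> / 2 * real (card (incident_edges E k))) * (u - v)\<^sup>2" for u
      unfolding q_def by (rule local_quadratic_expansion)
  qed (use assms in auto)
  then show ?thesis by (simp add: sum_distrib_right)
qed

lemma sync_sequence_dual:
  fixes E :: "('n::finite \<times> 'n) set"
  assumes sync: "sync_sequence E f \<rho> a x z y" and "e \<in> E" "k = fst e \<or> k = snd e"
  shows sync_sequence_dual_0: "edge_coord (y 0) e k = 0"
    and sync_sequence_dual_Suc:
      "edge_coord (y (Suc t)) e k = edge_coord (y t) e k + \<rho> * (edge_mean (x t) e - x t $ k)"
proof -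
  have e: "e \<in> incident_edges E k" using assms(2,3) by (simp add: incident_edges_def)
  show "edge_coord (y 0) e k = 0"
    using sync e unfolding sync_sequence_def by blast
  show "edge_coord (y (Suc t)) e k = edge_coord (y t) e k + \<rho> * (edge_mean (x t) e - x t $ k)"
    using sync e unfolding sync_sequence_def by blast
qed

text \<open>The mean is equidistant from the two endpoint values, so the increments at the two ends
  are opposite, and both coordinates start at zero.\<close>

lemma sync_sequence_dual_antisym:
  fixes E :: "('n::finite \<times> 'n) set"
  assumes "sync_sequence E f \<rho> a x z y" "e \<in> E"
  shows "edge_coord (y t) e (snd e) = - edge_coord (y t) e (fst e)"
proof (induction t)
  case 0
  show ?case by (simp add: sync_sequence_dual_0[OF assms])
next
  case (Suc t)
  then show ?case
    by (simp add: sync_sequence_dual_Suc[OF assms] edge_mean_def field_simps)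
qed

text \<open>\<open>z (Suc t)\<close> is the mean of the previous iterate \<open>x t\<close>, so a
  residual coordinate is plus or minus the new half-difference, minus the change of the
  mean.\<close>

lemma sync_residual_tendsto_zero:
  fixes E :: "('n::finite \<times> 'n) set"
  assumes "sync_sequence E f \<rho> a x z y"
    and d: "\<And>e. e \<in> E \<Longrightarrow> (\<lambda>t. edge_diff (x t) e) \<longlonglongrightarrow> 0"
    and s: "\<And>e. e \<in> E \<Longrightarrow> (\<lambda>t. edge_mean (x (Suc t)) e - edge_mean (x t) e) \<longlonglongrightarrow> 0"
  shows "(\<lambda>t. edge_norm E (\<lambda>e. z t e - M_stack (x t) e)) \<longlonglongrightarrow> 0"
proof -
  have "(\<lambda>t. z (Suc t) e - M_stack (x (Suc t)) e) \<longlonglongrightarrow> 0" if e: "e \<in> E" for e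
  proof (rule vec_tendstoI)
    fix i :: 2
    let ?r = "\<lambda>c t. c * edge_diff (x (Suc t)) e - (edge_mean (x (Suc t)) e - edge_mean (x t) e)"
    have z: "z (Suc t) e = edge_mean (x t) e *\<^sub>R vec 1" for t
      using assms(1) e by (simp add: sync_sequence_def)
    have "?r c \<longlonglongrightarrow> c * 0 - 0" for c
      using LIMSEQ_Suc[OF d[OF e]] s[OF e] by (intro tendsto_intros)
    then have "?r c \<longlonglongrightarrow> 0" for c by simp
    moreover have "(z (Suc t) e - M_stack (x (Suc t)) e) $ i = ?r (if i = 1 then 1 else - 1) t" for t
      using exhaust_2[of i]
      by (auto simp: z M_stack_component edge_diff_def edge_mean_def field_simps)
    ultimately show "(\<lambda>t. (z (Suc t) e - M_stack (x (Suc t)) e) $ i) \<longlonglongrightarrow> 0 $ i" by simp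
  qed
  then have "(\<lambda>t. sqrt (\<Sum>e\<in>E. (norm (z (Suc t) e - M_stack (x (Suc t)) e))\<^sup>2))
      \<longlonglongrightarrow> sqrt (\<Sum>e\<in>E. (norm (0 :: real^2))\<^sup>2)"
    by (intro tendsto_intros)
  then have "(\<lambda>t. edge_norm E (\<lambda>e. z (Suc t) e - M_stack (x (Suc t)) e)) \<longlonglongrightarrow> 0"
    by (simp add: edge_norm_def L2_set_def)
  then show ?thesis by (rule LIMSEQ_imp_Suc)
qed

section \<open>Energy inequalities along the iteration and their limit\<close>

theorem theorem3p3:
  fixes E :: "('n::finite \<times> 'n) set"
    and f :: "'n \<Rightarrow> real \<Rightarrow> ereal"
    and \<rho> :: real
    and a xs :: "real^'n"
    and zs ys :: "'n edge_vec"
    and x :: "nat \<Rightarrow> real^'n"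
    and z y :: "nat \<Rightarrow> 'n edge_vec"
  assumes "CARD('n) \<ge> 2"
    and "simple_graph E" and "connected_graph E" and "\<not> bipartite_graph E"
    and "\<And>k. closed_fun (f k)" and "\<And>k. proper_fun (f k)" and "\<And>k. convex_fun (f k)"
    and "\<rho> > 0"
    and "saddle_point E f xs zs ys"
    and "sync_sequence E f \<rho> a x z y"
  shows "((\<lambda>t. edge_norm E (\<lambda>e. z t e - M_stack (x t) e)) \<longlonglongrightarrow> 0) \<and>
         ((\<lambda>t. f_total f (x t)) \<longlonglongrightarrow> f_total f xs)"
proof -
  note proper = assms(6) and saddle = assms(9) and sync = assms(10)
  define b where "b t e = edge_coord (y t) e (fst e)" for t e
  have b_Suc: "b (Suc t) e = b t e + \<rho> * edge_diff (x t) e" if "e \<in> E" for t e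
    by (simp add: sync_sequence_dual_Suc[OF sync that] b_def edge_diff_def edge_mean_def field_simps)
  have min: "local_objective E f \<rho> (edge_mean (x t)) (y (Suc t)) k (x (Suc t) $ k)
      \<le> local_objective E f \<rho> (edge_mean (x t)) (y (Suc t)) k w" for t k w
  proof -
    obtain \<alpha> \<beta> where "\<And>v. ereal (\<alpha> + \<beta> * v) \<le> f k v"
      using saddle_point_affine_minorant[OF proper saddle] by blast
    then have "\<exists>v. \<forall>w. local_objective E f \<rho> (edge_mean (x t)) (y (Suc t)) k v
        \<le> local_objective E f \<rho> (edge_mean (x t)) (y (Suc t)) k w"
      by (intro local_objective_minimiser_exists assms(5) proper \<open>\<rho> > 0\<close>
          incident_edges_nonempty[OF assms(1,3)])
    from arg_min_le[OF this] show ?thesis using sync by (simp add: sync_sequence_def)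
  qed
  define ps where "ps k = real_of_ereal (f k (xs $ k))" for k
  have ps: "f k (xs $ k) = ereal (ps k)" for k
    unfolding ps_def by (rule saddle_point_finite(1)[OF proper saddle])
  define p where "p t k = real_of_ereal (f k (x t $ k))" for t k
  \<comment> \<open>Comparison with the finite value at \<open>xs\<close> gives finiteness from the
    first update on; \<open>p 0 k\<close> may be only the default of
    \<open>real_of_ereal\<close>.\<close>
  have p: "f k (x (Suc t) $ k) = ereal (p (Suc t) k)" for t k
  proof -
    have "f k (x (Suc t) $ k) \<noteq> \<infinity>"
      using min[of t k "xs $ k"] by (auto simp: local_objective_def ps)
    moreover have "f k (x (Suc t) $ k) \<noteq> -\<infinity>" using proper by (simp add: proper_fun_def)
    ultimately show ?thesis unfolding p_def by (cases "f k (x (Suc t) $ k)") auto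
  qed
  define \<phi> where "\<phi> t = (\<Sum>k\<in>UNIV. p t k)" for t
  define \<phi>s where "\<phi>s = (\<Sum>k\<in>UNIV. ps k)"
  have fx: "f_total f (x (Suc t)) = ereal (\<phi> (Suc t))" for t
    unfolding \<phi>_def by (rule f_total_eq_ereal) (rule p)
  have fxs: "f_total f xs = ereal \<phi>s"
    unfolding \<phi>s_def by (rule f_total_eq_ereal) (rule ps)
  have lower: "\<phi>s - 2 * (\<Sum>e\<in>E. ys e $ 1 * edge_diff (x (Suc t)) e) \<le> \<phi> (Suc t)" for t
    using saddle_point_KKT(2)[OF proper saddle, of "x (Suc t)"] by (simp add: fx fxs)
  have upper: "\<phi> (Suc t) + 2 * (\<Sum>e\<in>E. b (Suc (Suc t)) e * edge_diff (x (Suc t)) e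
      + \<rho> * (edge_mean (x (Suc t)) e - edge_mean (x t) e) * (edge_mean (x (Suc t)) e - edge_mean xs e))
      \<le> \<phi>s" for t
  proof -
    \<comment> \<open>The multiplier here contains the mean of \<open>x t\<close>, whereas the next
      dual update uses that of \<open>x (Suc t)\<close>; the mismatch yields the term with the
      change of the mean.\<close>
    define c where "c e k = (edge_coord (y (Suc t)) e k + \<rho> * (edge_mean (x t) e - x (Suc t) $ k))
        * (xs $ k - x (Suc t) $ k)" for e k
    have "p (Suc t) k + (\<Sum>e\<in>incident_edges E k. c e k) \<le> ps k" for k
      unfolding c_def by (rule local_objective_subgradient[OF assms(7) p ps min])
    then have "(\<Sum>k\<in>UNIV. p (Suc t) k + (\<Sum>e\<in>incident_edges E k. c e k)) \<le> \<phi>s"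
      unfolding \<phi>s_def by (rule sum_mono)
    then have "\<phi> (Suc t) + (\<Sum>e\<in>E. c e (fst e) + c e (snd e)) \<le> \<phi>s"
      by (simp add: sum.distrib \<phi>_def sum_incident_edges[OF assms(2)])
    also have "(\<Sum>e\<in>E. c e (fst e) + c e (snd e)) = 2 * (\<Sum>e\<in>E. b (Suc (Suc t)) e * edge_diff (x (Suc t)) e
      + \<rho> * (edge_mean (x (Suc t)) e - edge_mean (x t) e) * (edge_mean (x (Suc t)) e - edge_mean xs e))"
      unfolding sum_distrib_left
    proof (rule sum.cong)
      fix e assume e: "e \<in> E"
      define d s s' where "d = edge_diff (x (Suc t)) e" and "s = edge_mean (x t) e"
        and "s' = edge_mean (x (Suc t)) e"
      have x': "x (Suc t) $ fst e = s' - d" "x (Suc t) $ snd e = s' + d"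
        by (simp_all add: d_def s'_def edge_diff_def edge_mean_def field_simps)
      have xs: "xs $ fst e = edge_mean xs e" "xs $ snd e = edge_mean xs e"
        using saddle_point_KKT(1)[OF proper saddle e] by (simp_all add: edge_mean_def)
      have "c e (fst e) + c e (snd e) = (b (Suc t) e + \<rho> * (s - (s' - d))) * (edge_mean xs e - (s' - d))
          + (- b (Suc t) e + \<rho> * (s - (s' + d))) * (edge_mean xs e - (s' + d))"
        unfolding c_def sync_sequence_dual_antisym[OF sync e] b_def[symmetric] x' xs s_def[symmetric] ..
      \<comment> \<open>The opposite signs at the two endpoints cancel all products mixing
        \<open>b (Suc t) e\<close> or \<open>d\<close> with differences of means.\<close>
      also have "\<dots> = 2 * ((b (Suc t) e + \<rho> * d) * d + \<rho> * (s' - s) * (s' - edge_mean xs e))"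
        by (simp add: algebra_simps)
      finally show "c e (fst e) + c e (snd e) = 2 * (b (Suc (Suc t)) e * edge_diff (x (Suc t)) e
          + \<rho> * (edge_mean (x (Suc t)) e - edge_mean (x t) e) * (edge_mean (x (Suc t)) e - edge_mean xs e))"
        by (simp add: b_Suc[OF e, of "Suc t"] d_def s_def s'_def)
    qed simp
    finally show ?thesis .
  qed
  have "finite E" by simp
  note conv = scalar_admm_convergence[where s = "\<lambda>t. edge_mean (x t)",
      OF \<open>finite E\<close> \<open>\<rho> > 0\<close> b_Suc upper lower]
  show ?thesis
  proof
    show "(\<lambda>t. edge_norm E (\<lambda>e. z t e - M_stack (x t) e)) \<longlonglongrightarrow> 0"
      by (rule sync_residual_tendsto_zero[OF sync conv(1,2)])
    have "(\<lambda>t. f_total f (x (Suc t))) \<longlonglongrightarrow> f_total f xs"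
      unfolding fx fxs using LIMSEQ_Suc[OF conv(3)] by simp
    then show "(\<lambda>t. f_total f (x t)) \<longlonglongrightarrow> f_total f xs"
      by (rule LIMSEQ_imp_Suc)
  qed
qed

end
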